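(* Let $n\ge3$, let $t$ be an indeterminate, let $v(t)\in\mathbb{Z}[t^{\pm1}]$ be invertible in $\mathbb{Z}[t^{\pm1}]$, and let $\eta_1':VST_n\to\mathrm{GL}_n(\mathbb{Z}[t^{\pm1}])$ be the representation of the virtual singular twin group given, for $1\le i\le n-1$, by $$\eta_1'(s_i)=\begin{pmatrix} I_{i-1}&0&0&0\\0&1-t&t&0\\0&2-t&t-1&0\\0&0&0&I_{n-i-1}\end{pmatrix},\qquad \eta_1'(\tau_i)=I_n,\qquad \eta_1'(\nu_i)=\begin{pmatrix} I_{i-1}&0&0&0\\0&0&v(t)&0\\0&\frac{1}{v(t)}&0&0\\0&0&0&I_{n-i-1}\end{pmatrix}.$$ Then $\eta_1'$ is irreducible if and only if $v(t)\ne1$.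
   Context: The virtual singular twin group $VST_n$ is the group generated by $s_i,\tau_i,\nu_i$ ($1\le i\le n-1$) subject to: $s_i^2=1$, $\nu_i^2=1$ and $\tau_is_i=s_i\tau_i$ for all $i$; $s_is_j\tau_i=\tau_js_is_j$, $\nu_i\nu_j\nu_i=\nu_j\nu_i\nu_j$, $\nu_is_j\nu_i=\nu_js_i\nu_j$, $\nu_i\tau_j\nu_i=\nu_j\tau_i\nu_j$ for $|i-j|=1$; and $g_ih_j=h_jg_i$ for $|i-j|\ge 2$, where $g_i,h_i\in\{s_i,\tau_i,\nu_i\}$. $I_r$ is the $r\times r$ identity matrix. Matrices over $\mathbb{Z}[t^{\pm1}]$ act on column vectors in $\mathbb{Z}^n[t^{\pm1}]$. A representation is irreducible if it does not admit a proper nontrivial invariant subspace, i.e. it does not have a nontrivial subrepresentation; otherwise it is reducible. *)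

theory Defs
  imports "Jordan_Normal_Form.VS_Connect" "HOL-Library.Poly_Mapping"
    "HOL-Computational_Algebra.Fraction_Field"
begin

section \<open>Laurent polynomials\<close>

text \<open>
  Finitely supported functions on the exponents, with convolution as multiplication:
  this is the group ring of the infinite cyclic group, i.e. the ring of Laurent polynomials
  in one indeterminate with integer coefficients.
\<close>

type_synonym laurent = "int \<Rightarrow>\<^sub>0 int"

definition indet :: laurent where
  "indet = Poly_Mapping.single 1 1"


section \<open>Groups given by generators and relations\<close>

text \<open>The letter \<open>(x, True)\<close> stands for \<open>x\<close>, the letter \<open>(x, False)\<close> for its inverse.\<close>

type_synonym 'g word = "('g \<times> bool) list"

definition words :: "'g set \<Rightarrow> 'g word set" where
  "words X = lists (X \<times> UNIV)"

definition pos_word :: "'g list \<Rightarrow> 'g word" where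
  "pos_word xs = map (\<lambda>x. (x, True)) xs"

text \<open>A pair \<open>(u, v)\<close> in the set of relations stands for the relation \<open>u = v\<close>.\<close>

inductive pres_eq :: "'g set \<Rightarrow> ('g word \<times> 'g word) set \<Rightarrow> 'g word \<Rightarrow> 'g word \<Rightarrow> bool"
  for X R where
  refl: "u \<in> words X \<Longrightarrow> pres_eq X R u u"
| sym: "pres_eq X R u v \<Longrightarrow> pres_eq X R v u"
| trans: "pres_eq X R u v \<Longrightarrow> pres_eq X R v w \<Longrightarrow> pres_eq X R u w"
| cancel: "a \<in> words X \<Longrightarrow> b \<in> words X \<Longrightarrow> x \<in> X \<Longrightarrow>
    pres_eq X R (a @ [(x, e), (x, \<not> e)] @ b) (a @ b)"
| relation: "a \<in> words X \<Longrightarrow> b \<in> words X \<Longrightarrow> (u, v) \<in> R \<Longrightarrow>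
    pres_eq X R (a @ u @ b) (a @ v @ b)"

definition pres_class :: "'g set \<Rightarrow> ('g word \<times> 'g word) set \<Rightarrow> 'g word \<Rightarrow> 'g word set" where
  "pres_class X R w = {u. pres_eq X R w u}"

definition presented_group ::
  "'g set \<Rightarrow> ('g word \<times> 'g word) set \<Rightarrow> 'g word set monoid" where
  "presented_group X R =
    \<lparr>carrier = pres_class X R ` words X,
     mult = (\<lambda>A B. \<Union>a\<in>A. \<Union>b\<in>B. pres_class X R (a @ b)),
     one = pres_class X R []\<rparr>"

context
  fixes X :: "'g set" and R :: "('g word \<times> 'g word) set"
  assumes R: "R \<subseteq> words X \<times> words X"
begin

lemma pres_eq_words: "pres_eq X R u v \<Longrightarrow> u \<in> words X \<and> v \<in> words X"
  by (induction rule: pres_eq.induct) (use R in \<open>auto simp: words_def\<close>)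

lemma pres_eq_context:
  assumes "pres_eq X R u v" "a \<in> words X" "b \<in> words X"
  shows "pres_eq X R (a @ u @ b) (a @ v @ b)"
  using assms(1)
proof induction
  case (refl u)
  then show ?case using assms(2,3) by (intro pres_eq.refl) (auto simp: words_def)
next
  case (sym u v)
  show ?case by (rule pres_eq.sym[OF sym.IH])
next
  case (trans u v w)
  show ?case by (rule pres_eq.trans[OF trans.IH])
next
  case (cancel c d x e)
  then show ?case
    using pres_eq.cancel[of "a @ c" X "d @ b" x R e] assms(2,3) by (auto simp: words_def)
next
  case (relation c d u v)
  then show ?case
    using pres_eq.relation[of "a @ c" X "d @ b" u v R] assms(2,3) by (auto simp: words_def)
qed

lemma pres_eq_append:
  assumes "pres_eq X R u u'" "pres_eq X R v v'"
  shows "pres_eq X R (u @ v) (u' @ v')"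
proof -
  have "pres_eq X R ([] @ u @ v) ([] @ u' @ v)"
    by (rule pres_eq_context) (use assms pres_eq_words in \<open>auto simp: words_def\<close>)
  moreover have "pres_eq X R (u' @ v @ []) (u' @ v' @ [])"
    by (rule pres_eq_context) (use assms pres_eq_words in \<open>auto simp: words_def\<close>)
  ultimately show ?thesis using pres_eq.trans by fastforce
qed

lemma pres_class_eq_iff:
  assumes "u \<in> words X"
  shows "pres_class X R u = pres_class X R v \<longleftrightarrow> pres_eq X R u v"
proof
  assume "pres_class X R u = pres_class X R v"
  then have "u \<in> pres_class X R v"
    using pres_eq.refl[OF assms, of R] by (auto simp: pres_class_def)
  then show "pres_eq X R u v" by (auto simp: pres_class_def intro: pres_eq.sym)
next
  assume uv: "pres_eq X R u v"
  have "pres_eq X R u w \<longleftrightarrow> pres_eq X R v w" for w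
    using pres_eq.trans[OF uv] pres_eq.trans[OF pres_eq.sym[OF uv]] by blast
  then show "pres_class X R u = pres_class X R v" by (simp add: pres_class_def)
qed

lemma pres_class_mult:
  assumes "u \<in> words X" "v \<in> words X"
  shows "pres_class X R u \<otimes>\<^bsub>presented_group X R\<^esub> pres_class X R v = pres_class X R (u @ v)"
proof -
  have *: "pres_class X R (a @ b) = pres_class X R (u @ v)"
    if "a \<in> pres_class X R u" "b \<in> pres_class X R v" for a b
  proof -
    have "pres_eq X R (u @ v) (a @ b)"
      using that by (intro pres_eq_append) (simp_all add: pres_class_def)
    moreover have "u @ v \<in> words X" using assms by (simp add: words_def)
    ultimately show ?thesis using pres_class_eq_iff[of "u @ v" "a @ b"] by simp
  qed
  have "u \<in> pres_class X R u" "v \<in> pres_class X R v"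
    using assms by (auto simp: pres_class_def intro: pres_eq.refl)
  then have "(\<Union>a\<in>pres_class X R u. \<Union>b\<in>pres_class X R v. pres_class X R (a @ b)) =
      pres_class X R (u @ v)"
    using * by blast
  then show ?thesis by (simp add: presented_group_def)
qed

lemma pres_word_inverse:
  "w \<in> words X \<Longrightarrow> \<exists>w'\<in>words X. pres_eq X R (w' @ w) []"
proof (induction w)
  case Nil
  then show ?case by (intro bexI[of _ "[]"]) (auto intro: pres_eq.refl)
next
  case (Cons y w)
  obtain x e where y: "y = (x, e)" by (cases y)
  from Cons.prems y have x: "x \<in> X" and w: "w \<in> words X" by (auto simp: words_def)
  from Cons.IH[OF w] obtain w' where w': "w' \<in> words X" "pres_eq X R (w' @ w) []" by blast
  have "pres_eq X R (w' @ [(x, \<not> e), (x, \<not> \<not> e)] @ w) (w' @ w)"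
    by (rule pres_eq.cancel[OF w'(1) w x])
  then have "pres_eq X R ((w' @ [(x, \<not> e)]) @ y # w) []"
    using pres_eq.trans[OF _ w'(2)] by (simp add: y)
  moreover have "w' @ [(x, \<not> e)] \<in> words X" using w'(1) x by (auto simp: words_def)
  ultimately show ?case by blast
qed

lemma group_presented_group: "group (presented_group X R)"
proof (rule groupI)
  show "\<one>\<^bsub>presented_group X R\<^esub> \<in> carrier (presented_group X R)"
    by (auto simp: presented_group_def words_def)
next
  fix A B
  assume "A \<in> carrier (presented_group X R)" "B \<in> carrier (presented_group X R)"
  then obtain a b where "a \<in> words X" "b \<in> words X" "A = pres_class X R a" "B = pres_class X R b"
    by (auto simp: presented_group_def)
  then show "A \<otimes>\<^bsub>presented_group X R\<^esub> B \<in> carrier (presented_group X R)"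
    by (auto simp: pres_class_mult) (auto simp: presented_group_def words_def)
next
  fix A B C
  assume "A \<in> carrier (presented_group X R)" "B \<in> carrier (presented_group X R)"
    "C \<in> carrier (presented_group X R)"
  then obtain a b c where "a \<in> words X" "b \<in> words X" "c \<in> words X"
    "A = pres_class X R a" "B = pres_class X R b" "C = pres_class X R c"
    by (auto simp: presented_group_def)
  moreover from this have "a @ b \<in> words X" "b @ c \<in> words X" by (auto simp: words_def)
  ultimately show "A \<otimes>\<^bsub>presented_group X R\<^esub> B \<otimes>\<^bsub>presented_group X R\<^esub> C =
      A \<otimes>\<^bsub>presented_group X R\<^esub> (B \<otimes>\<^bsub>presented_group X R\<^esub> C)"
    by (simp add: pres_class_mult)
next
  fix A
  assume "A \<in> carrier (presented_group X R)"
  then obtain a where a: "a \<in> words X" "A = pres_class X R a"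
    by (auto simp: presented_group_def)
  have nil: "[] \<in> words X" and one: "\<one>\<^bsub>presented_group X R\<^esub> = pres_class X R []"
    by (auto simp: words_def presented_group_def)
  show "\<one>\<^bsub>presented_group X R\<^esub> \<otimes>\<^bsub>presented_group X R\<^esub> A = A"
    unfolding one a(2) pres_class_mult[OF nil a(1)] by simp
  obtain a' where a': "a' \<in> words X" "pres_eq X R (a' @ a) []"
    using pres_word_inverse[OF a(1)] by blast
  have "a' @ a \<in> words X" using a' a by (auto simp: words_def)
  then have "pres_class X R a' \<otimes>\<^bsub>presented_group X R\<^esub> A = \<one>\<^bsub>presented_group X R\<^esub>"
    unfolding one a(2) pres_class_mult[OF a'(1) a(1)]
    using pres_class_eq_iff a'(2) by blast
  moreover have "pres_class X R a' \<in> carrier (presented_group X R)"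
    using a'(1) by (auto simp: presented_group_def)
  ultimately show "\<exists>B\<in>carrier (presented_group X R).
      B \<otimes>\<^bsub>presented_group X R\<^esub> A = \<one>\<^bsub>presented_group X R\<^esub>"
    by blast
qed

end


section \<open>The virtual singular twin group\<close>

datatype vst_gen = Gen_s nat | Gen_tau nat | Gen_nu nat

definition vst_gens :: "nat \<Rightarrow> vst_gen set" where
  "vst_gens n = (\<Union>i\<in>{1..n - 1}. {Gen_s i, Gen_tau i, Gen_nu i})"

inductive_set vst_rels :: "nat \<Rightarrow> (vst_gen list \<times> vst_gen list) set" for n :: nat where
  "i \<in> {1..n - 1} \<Longrightarrow> ([Gen_s i, Gen_s i], []) \<in> vst_rels n"
| "i \<in> {1..n - 1} \<Longrightarrow> ([Gen_nu i, Gen_nu i], []) \<in> vst_rels n"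
| "i \<in> {1..n - 1} \<Longrightarrow> ([Gen_tau i, Gen_s i], [Gen_s i, Gen_tau i]) \<in> vst_rels n"
| "i \<in> {1..n - 1} \<Longrightarrow> j \<in> {1..n - 1} \<Longrightarrow> \<bar>int i - int j\<bar> = 1 \<Longrightarrow>
    ([Gen_s i, Gen_s j, Gen_tau i], [Gen_tau j, Gen_s i, Gen_s j]) \<in> vst_rels n"
| "i \<in> {1..n - 1} \<Longrightarrow> j \<in> {1..n - 1} \<Longrightarrow> \<bar>int i - int j\<bar> = 1 \<Longrightarrow>
    ([Gen_nu i, Gen_nu j, Gen_nu i], [Gen_nu j, Gen_nu i, Gen_nu j]) \<in> vst_rels n"
| "i \<in> {1..n - 1} \<Longrightarrow> j \<in> {1..n - 1} \<Longrightarrow> \<bar>int i - int j\<bar> = 1 \<Longrightarrow>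
    ([Gen_nu i, Gen_s j, Gen_nu i], [Gen_nu j, Gen_s i, Gen_nu j]) \<in> vst_rels n"
| "i \<in> {1..n - 1} \<Longrightarrow> j \<in> {1..n - 1} \<Longrightarrow> \<bar>int i - int j\<bar> = 1 \<Longrightarrow>
    ([Gen_nu i, Gen_tau j, Gen_nu i], [Gen_nu j, Gen_tau i, Gen_nu j]) \<in> vst_rels n"
| "i \<in> {1..n - 1} \<Longrightarrow> j \<in> {1..n - 1} \<Longrightarrow> \<bar>int i - int j\<bar> \<ge> 2 \<Longrightarrow>
    g \<in> {Gen_s i, Gen_tau i, Gen_nu i} \<Longrightarrow> h \<in> {Gen_s j, Gen_tau j, Gen_nu j} \<Longrightarrow>
    ([g, h], [h, g]) \<in> vst_rels n"

definition vst_word_rels :: "nat \<Rightarrow> (vst_gen word \<times> vst_gen word) set" where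
  "vst_word_rels n = (\<lambda>(u, v). (pos_word u, pos_word v)) ` vst_rels n"

definition VST :: "nat \<Rightarrow> vst_gen word set monoid" where
  "VST n = presented_group (vst_gens n) (vst_word_rels n)"

definition vst_elem :: "nat \<Rightarrow> vst_gen \<Rightarrow> vst_gen word set" where
  "vst_elem n g = pres_class (vst_gens n) (vst_word_rels n) (pos_word [g])"

abbreviation vst_s :: "nat \<Rightarrow> nat \<Rightarrow> vst_gen word set" where
  "vst_s n i \<equiv> vst_elem n (Gen_s i)"

abbreviation vst_tau :: "nat \<Rightarrow> nat \<Rightarrow> vst_gen word set" where
  "vst_tau n i \<equiv> vst_elem n (Gen_tau i)"

abbreviation vst_nu :: "nat \<Rightarrow> nat \<Rightarrow> vst_gen word set" where
  "vst_nu n i \<equiv> vst_elem n (Gen_nu i)"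

lemma vst_word_rels_words: "vst_word_rels n \<subseteq> words (vst_gens n) \<times> words (vst_gens n)"
proof -
  have "pos_word u \<in> words (vst_gens n) \<and> pos_word v \<in> words (vst_gens n)"
    if "(u, v) \<in> vst_rels n" for u v
    using that by cases (auto simp: pos_word_def words_def vst_gens_def)
  then show ?thesis by (auto simp: vst_word_rels_def)
qed

lemma group_VST: "group (VST n)"
  unfolding VST_def by (rule group_presented_group[OF vst_word_rels_words])


section \<open>Irreducible matrix representations\<close>

definition GL :: "nat \<Rightarrow> 'a :: comm_ring_1 mat monoid" where
  "GL n = units_of (ring_mat TYPE('a) n ())"

text \<open>
  Subspaces of \<open>R\<^sup>n\<close> for an integral domain \<open>R\<close>, with quotient field \<open>K\<close>.
  Submodules that are not closed under division by scalars have to be excluded: for every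
  non-unit \<open>r \<noteq> 0\<close>, the submodule \<open>r R\<^sup>n\<close> is proper, nonzero, and invariant under
  every matrix over \<open>R\<close>.  The remaining ones are exactly the sets of points of \<open>R\<^sup>n\<close> on a
  linear subspace of \<open>K\<^sup>n\<close>, see \<open>vec_subspace_iff_fract\<close> below.
\<close>

definition vec_subspace :: "nat \<Rightarrow> 'a :: idom vec set \<Rightarrow> bool" where
  "vec_subspace n W \<longleftrightarrow>
     submodule class_ring W (module_vec TYPE('a) n) \<and>
     (\<forall>r. \<forall>x \<in> carrier_vec n. r \<noteq> 0 \<longrightarrow> r \<cdot>\<^sub>v x \<in> W \<longrightarrow> x \<in> W)"

definition invariant_subspace ::
  "('g, 'b) monoid_scheme \<Rightarrow> nat \<Rightarrow> ('g \<Rightarrow> 'a :: idom mat) \<Rightarrow> 'a vec set \<Rightarrow> bool" where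
  "invariant_subspace G n \<rho> W \<longleftrightarrow>
     vec_subspace n W \<and> (\<forall>g \<in> carrier G. \<forall>x \<in> W. \<rho> g *\<^sub>v x \<in> W)"

definition irreducible_rep ::
  "('g, 'b) monoid_scheme \<Rightarrow> nat \<Rightarrow> ('g \<Rightarrow> 'a :: idom mat) \<Rightarrow> bool" where
  "irreducible_rep G n \<rho> \<longleftrightarrow>
     \<not> (\<exists>W. invariant_subspace G n \<rho> W \<and> W \<noteq> {0\<^sub>v n} \<and> W \<noteq> carrier_vec n)"

lemma submodule_vec_iff:
  fixes W :: "'a :: comm_ring_1 vec set"
  shows "submodule class_ring W (module_vec TYPE('a) n) \<longleftrightarrow>
     W \<subseteq> carrier_vec n \<and> 0\<^sub>v n \<in> W \<and>
     (\<forall>x\<in>W. \<forall>y\<in>W. x + y \<in> W) \<and> (\<forall>c. \<forall>x\<in>W. c \<cdot>\<^sub>v x \<in> W)"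
  (is "_ \<longleftrightarrow> ?rhs")
proof -
  have module: "module class_ring (module_vec TYPE('a) n)"
  proof -
    interpret vec_module "TYPE('a)" n .
    show ?thesis by (rule module_axioms)
  qed
  show ?thesis
  proof
    assume W: "submodule class_ring W (module_vec TYPE('a) n)"
    show ?rhs
      using submodule.subset[OF W] submodule.zero_closed[OF W] submodule.m_closed[OF W]
        submodule.smult_closed[OF W]
      by (simp add: module_vec_simps)
  next
    assume ?rhs
    then show "submodule class_ring W (module_vec TYPE('a) n)"
      by (intro submodule.intro module) (simp_all add: module_vec_simps)
  qed
qed

definition vec_to_fract :: "'a :: idom vec \<Rightarrow> 'a fract vec" where
  "vec_to_fract = map_vec (\<lambda>a. Fract a 1)"

lemma vec_subspace_iff_fract:
  fixes W :: "'a :: idom vec set"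
  shows "vec_subspace n W \<longleftrightarrow>
     (\<exists>U. subspace class_ring U (module_vec TYPE('a fract) n) \<and>
          W = {x \<in> carrier_vec n. vec_to_fract x \<in> U})"
proof -
  let ?f = "vec_to_fract :: 'a vec \<Rightarrow> _"
  have carrier: "?f x \<in> carrier_vec n \<longleftrightarrow> x \<in> carrier_vec n" for x
    by (simp add: vec_to_fract_def)
  have zero: "?f (0\<^sub>v n) = 0\<^sub>v n"
    by (auto simp: vec_to_fract_def Zero_fract_def)
  have add: "?f (x + y) = ?f x + ?f y" if "x \<in> carrier_vec n" "y \<in> carrier_vec n" for x y
    using that by (auto simp: vec_to_fract_def)
  have smult: "?f (c \<cdot>\<^sub>v x) = Fract c 1 \<cdot>\<^sub>v ?f x" for c x
    by (auto simp: vec_to_fract_def)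
  have inj: "x = y" if "?f x = ?f y" for x y
  proof -
    from that have dim: "dim_vec x = dim_vec y"
      by (metis index_map_vec(2) vec_to_fract_def)
    moreover have "x $ i = y $ i" if "i < dim_vec y" for i
    proof -
      have "?f x $ i = ?f y $ i" using \<open>?f x = ?f y\<close> by simp
      then show ?thesis using that dim by (simp add: vec_to_fract_def eq_fract)
    qed
    ultimately show ?thesis by (intro eq_vecI)
  qed
  have vs: "vectorspace class_ring (module_vec TYPE('a fract) n)"
  proof -
    interpret vec_space "TYPE('a fract)" n .
    show ?thesis by (rule vectorspace_axioms)
  qed
  have subspace_iff: "subspace class_ring U (module_vec TYPE('a fract) n) \<longleftrightarrow>
      U \<subseteq> carrier_vec n \<and> 0\<^sub>v n \<in> U \<and>
      (\<forall>x\<in>U. \<forall>y\<in>U. x + y \<in> U) \<and> (\<forall>c. \<forall>x\<in>U. c \<cdot>\<^sub>v x \<in> U)" for U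
    unfolding subspace_def using vs by (simp only: submodule_vec_iff simp_thms)
  show ?thesis
  proof
    assume W: "vec_subspace n W"
    then have sub: "W \<subseteq> carrier_vec n" and W0: "0\<^sub>v n \<in> W"
      and Wadd: "\<And>x y. x \<in> W \<Longrightarrow> y \<in> W \<Longrightarrow> x + y \<in> W"
      and Wsm: "\<And>c x. x \<in> W \<Longrightarrow> c \<cdot>\<^sub>v x \<in> W"
      and pure: "\<And>r x. x \<in> carrier_vec n \<Longrightarrow> r \<noteq> 0 \<Longrightarrow> r \<cdot>\<^sub>v x \<in> W \<Longrightarrow> x \<in> W"
      unfolding vec_subspace_def submodule_vec_iff by blast+
    define U where "U = {y \<in> carrier_vec n. \<exists>r x. r \<noteq> 0 \<and> x \<in> W \<and> Fract r 1 \<cdot>\<^sub>v y = ?f x}"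
    have "subspace class_ring U (module_vec TYPE('a fract) n)"
      unfolding subspace_iff
    proof (intro conjI ballI allI)
      show "U \<subseteq> carrier_vec n" by (auto simp: U_def)
      show "0\<^sub>v n \<in> U"
        unfolding U_def using W0 zero
        by (intro CollectI conjI exI[of _ 1] exI[of _ "0\<^sub>v n"]) auto
    next
      fix y y' assume "y \<in> U" "y' \<in> U"
      then obtain r x r' x' where y: "y \<in> carrier_vec n" "r \<noteq> 0" "x \<in> W" "Fract r 1 \<cdot>\<^sub>v y = ?f x"
        and y': "y' \<in> carrier_vec n" "r' \<noteq> 0" "x' \<in> W" "Fract r' 1 \<cdot>\<^sub>v y' = ?f x'"
        by (auto simp: U_def)
      have "Fract (r * r') 1 \<cdot>\<^sub>v (y + y') =
          Fract r' 1 \<cdot>\<^sub>v (Fract r 1 \<cdot>\<^sub>v y) + Fract r 1 \<cdot>\<^sub>v (Fract r' 1 \<cdot>\<^sub>v y')"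
        using y(1) y'(1) by (simp add: smult_add_distrib_vec smult_smult_assoc mult.commute)
      also have "\<dots> = ?f (r' \<cdot>\<^sub>v x + r \<cdot>\<^sub>v x')"
        using y y' sub by (subst add) (auto simp: smult)
      finally have "Fract (r * r') 1 \<cdot>\<^sub>v (y + y') = ?f (r' \<cdot>\<^sub>v x + r \<cdot>\<^sub>v x')" .
      moreover have "r' \<cdot>\<^sub>v x + r \<cdot>\<^sub>v x' \<in> W" using y(3) y'(3) Wadd Wsm by blast
      ultimately show "y + y' \<in> U"
        unfolding U_def using y(1,2) y'(1,2)
        by (intro CollectI conjI exI[of _ "r * r'"] exI[of _ "r' \<cdot>\<^sub>v x + r \<cdot>\<^sub>v x'"]) auto
    next
      fix c :: "'a fract" and y assume "y \<in> U"
      then obtain r x where y: "y \<in> carrier_vec n" "r \<noteq> 0" "x \<in> W" "Fract r 1 \<cdot>\<^sub>v y = ?f x"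
        by (auto simp: U_def)
      obtain a b where c: "c = Fract a b" "b \<noteq> 0" by (cases c)
      have "Fract (r * b) 1 \<cdot>\<^sub>v (c \<cdot>\<^sub>v y) = Fract a 1 \<cdot>\<^sub>v (Fract r 1 \<cdot>\<^sub>v y)"
      proof -
        have "Fract (r * b) 1 * c = Fract a 1 * Fract r 1"
          using c by (simp add: eq_fract)
        then show ?thesis by (simp add: smult_smult_assoc)
      qed
      also have "\<dots> = ?f (a \<cdot>\<^sub>v x)" by (simp only: y(4) smult)
      finally show "c \<cdot>\<^sub>v y \<in> U"
        unfolding U_def using y c(2) Wsm
        by (intro CollectI conjI exI[of _ "r * b"] exI[of _ "a \<cdot>\<^sub>v x"]) auto
    qed
    moreover have "W = {x \<in> carrier_vec n. ?f x \<in> U}"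
    proof (intro equalityI subsetI)
      fix x assume x: "x \<in> W"
      have "Fract 1 1 \<cdot>\<^sub>v ?f x = ?f x" by (simp add: One_fract_def[symmetric])
      moreover have "x \<in> carrier_vec n" using x sub by blast
      ultimately show "x \<in> {x \<in> carrier_vec n. ?f x \<in> U}"
        unfolding U_def mem_Collect_eq carrier using x
        by (intro conjI exI[of _ 1] exI[of _ x]) simp_all
    next
      fix x assume "x \<in> {x \<in> carrier_vec n. ?f x \<in> U}"
      then obtain r x' where x: "x \<in> carrier_vec n" "r \<noteq> 0" "x' \<in> W" "Fract r 1 \<cdot>\<^sub>v ?f x = ?f x'"
        by (auto simp: U_def)
      then have "r \<cdot>\<^sub>v x = x'" by (intro inj) (simp add: smult)
      with x(3) have "r \<cdot>\<^sub>v x \<in> W" by simp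
      then show "x \<in> W" by (rule pure[OF x(1,2)])
    qed
    ultimately show "\<exists>U. subspace class_ring U (module_vec TYPE('a fract) n) \<and>
        W = {x \<in> carrier_vec n. ?f x \<in> U}"
      by blast
  next
    assume "\<exists>U. subspace class_ring U (module_vec TYPE('a fract) n) \<and>
        W = {x \<in> carrier_vec n. ?f x \<in> U}"
    then obtain U where U: "U \<subseteq> carrier_vec n" "0\<^sub>v n \<in> U"
        "\<And>x y. x \<in> U \<Longrightarrow> y \<in> U \<Longrightarrow> x + y \<in> U" "\<And>c x. x \<in> U \<Longrightarrow> c \<cdot>\<^sub>v x \<in> U"
      and W: "W = {x \<in> carrier_vec n. ?f x \<in> U}"
      unfolding subspace_iff by blast
    have W_iff: "x \<in> W \<longleftrightarrow> x \<in> carrier_vec n \<and> ?f x \<in> U" for x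
      by (simp add: W)
    have pure: "x \<in> W" if "r \<noteq> 0" "x \<in> carrier_vec n" "r \<cdot>\<^sub>v x \<in> W" for r x
    proof -
      have "Fract r 1 \<cdot>\<^sub>v ?f x \<in> U" using that(3) by (simp add: W_iff smult)
      then have "Fract 1 r \<cdot>\<^sub>v (Fract r 1 \<cdot>\<^sub>v ?f x) \<in> U" by (rule U(4))
      moreover have "Fract 1 r * Fract r 1 = 1"
        using that(1) by (simp add: One_fract_def eq_fract)
      ultimately show ?thesis using that(2) by (simp add: W_iff smult_smult_assoc)
    qed
    show "vec_subspace n W"
      unfolding vec_subspace_def submodule_vec_iff
    proof (intro conjI ballI allI impI)
      show "W \<subseteq> carrier_vec n" using W_iff by blast
      show "0\<^sub>v n \<in> W" using U(2) by (simp add: W_iff zero)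
      show "x + y \<in> W" if "x \<in> W" "y \<in> W" for x y
        using that U(3) by (simp add: W_iff add)
      show "c \<cdot>\<^sub>v x \<in> W" if "x \<in> W" for c x
        using that U(4) by (simp add: W_iff smult)
      show "x \<in> W" if "x \<in> carrier_vec n" "r \<noteq> 0" "r \<cdot>\<^sub>v x \<in> W" for r x
        using pure that by blast
    qed
  qed
qed

end

theory Submission
  imports Defs
begin

text \<open>
  Write \<open>S\<^sub>k\<close> and \<open>N\<^sub>k\<close> for the images of the \<open>k\<close>-th generators \<open>s\<close> and \<open>\<nu>\<close>.  Both
  differ from the identity by a matrix of rank one:
  \<open>(S\<^sub>k - 1) x = (x\<^bsub>k+1\<^esub> - x\<^sub>k) u\<^sub>k\<close> with \<open>u\<^sub>k = t e\<^sub>k + (t - 2) e\<^bsub>k+1\<^esub>\<close>, and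
  \<open>(N\<^sub>k - 1) x = (v x\<^bsub>k+1\<^esub> - x\<^sub>k) w\<^sub>k\<close> with \<open>w\<^sub>k = e\<^sub>k - v\<^sup>-\<^sup>1 e\<^bsub>k+1\<^esub>\<close>.
  So a constant vector, i.e. one whose coordinates are all equal, is fixed by every \<open>S\<^sub>k\<close>.  If
  \<open>v = 1\<close>, every \<open>N\<^sub>k\<close> fixes it as well, and hence so does the whole group
  (\<open>fixed_by_presented_group\<close>): the constant vectors form a proper invariant subspace.

  If \<open>v \<noteq> 1\<close>, a nonzero invariant subspace \<open>W\<close> contains a vector that is not constant, because
  \<open>N\<^sub>k\<close> maps nonzero constant vectors to vectors that are not constant.  Such a vector has different
  coordinates at some adjacent positions \<open>k\<close>, \<open>k + 1\<close>, and since \<open>W\<close> is closed under division by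
  nonzero scalars, the formula for \<open>S\<^sub>k - 1\<close> puts \<open>u\<^sub>k\<close> into \<open>W\<close>.  Applying \<open>N\<^sub>k - 1\<close> to
  \<open>u\<^sub>k\<close> gives \<open>w\<^sub>k \<in> W\<close>, unless \<open>v (t - 2) = t\<close>.  The vectors \<open>u\<^sub>k\<close> and \<open>w\<^sub>k\<close> are linearly
  independent, unless \<open>v (t - 2) = - t\<close>; so \<open>W\<close> contains \<open>e\<^sub>k\<close> and \<open>e\<^bsub>k+1\<^esub>\<close>.  The matrices
  \<open>N\<^sub>j\<close> permute the lines spanned by the unit vectors transitively, so \<open>W\<close> is everything
  (\<open>no_proper_common_invariant_subspace\<close>).

  The two exceptional equations have no solution among the Laurent polynomials, as \<open>t\<close> is a unit
  there and \<open>t - 2\<close> is not (\<open>indet_minus_2_not_dvd_odd_linear_monomial\<close>).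
\<close>

section \<open>Matrices acting on two adjacent coordinates\<close>

definition adjacent_block_mat ::
  "nat \<Rightarrow> nat \<Rightarrow> 'a \<Rightarrow> 'a \<Rightarrow> 'a \<Rightarrow> 'a \<Rightarrow> 'a :: comm_ring_1 mat" where
  "adjacent_block_mat n k a b c d =
     diag_block_mat [1\<^sub>m k, mat_of_rows_list 2 [[a, b], [c, d]], 1\<^sub>m (n - k - 2)]"

lemma adjacent_block_mat_carrier:
  assumes "Suc k < n"
  shows "adjacent_block_mat n k a b c d \<in> carrier_mat n n"
  using assms
  by (intro carrier_matI) (simp_all add: adjacent_block_mat_def dim_diag_block_mat mat_of_rows_list_def)

lemma adjacent_block_mat_index:
  assumes "Suc k < n" "i < n" "j < n"
  shows "adjacent_block_mat n k a b c d $$ (i, j) =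
    (if i = k then if j = k then a else if j = Suc k then b else 0
     else if i = Suc k then if j = k then c else if j = Suc k then d else 0
     else if i = j then 1 else 0)"
  using assms
  by (auto simp: adjacent_block_mat_def Let_def mat_of_rows_list_def nth_Cons split: nat.split)

lemma adjacent_block_mat_mult_vec:
  fixes x :: "'a :: comm_ring_1 vec"
  assumes k: "Suc k < n" and x: "x \<in> carrier_vec n"
  shows "adjacent_block_mat n k a b c d *\<^sub>v x =
    vec n (\<lambda>i. if i = k then a * x $ k + b * x $ Suc k
               else if i = Suc k then c * x $ k + d * x $ Suc k else x $ i)"
    (is "?A *\<^sub>v x = vec n ?f")
proof (rule eq_vecI)
  have A: "?A \<in> carrier_mat n n" by (rule adjacent_block_mat_carrier[OF k])
  fix i assume "i < dim_vec (vec n ?f)"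
  then have i: "i < n" by simp
  have "(?A *\<^sub>v x) $ i = (\<Sum>j\<in>{0..<n}. ?A $$ (i, j) * x $ j)"
    using A x i by (simp add: scalar_prod_def)
  also have "\<dots> = (\<Sum>j\<in>{i, k, Suc k}. ?A $$ (i, j) * x $ j)"
    using i k by (intro sum.mono_neutral_right) (auto simp: adjacent_block_mat_index)
  also have "\<dots> = ?f i"
  proof (cases "i = Suc k")
    case True
    then have "{i, k, Suc k} = {k, Suc k}" by auto
    then show ?thesis using True k by (simp add: adjacent_block_mat_index)
  qed (use i k in \<open>auto simp: adjacent_block_mat_index\<close>)
  finally show "(?A *\<^sub>v x) $ i = vec n ?f $ i" using i by simp
qed (use carrier_matD(1)[OF adjacent_block_mat_carrier[OF k]] in simp)


section \<open>Vectors fixed by a presented group\<close>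

text \<open>
  The generators alone do not produce the group as a monoid, but a letter that stands for an inverse
  acts by the inverse matrix, which fixes the same vectors.
\<close>

lemma fixed_by_presented_group:
  fixes \<rho> :: "'g word set \<Rightarrow> 'a :: comm_ring_1 mat"
  assumes R: "R \<subseteq> words X \<times> words X"
    and hom: "\<rho> \<in> hom (presented_group X R) (GL n)"
    and x: "x \<in> carrier_vec n"
    and gens: "\<And>g. g \<in> X \<Longrightarrow> \<rho> (pres_class X R (pos_word [g])) *\<^sub>v x = x"
    and A: "A \<in> carrier (presented_group X R)"
  shows "\<rho> A *\<^sub>v x = x"
proof -
  let ?G = "presented_group X R" and ?c = "pres_class X R"
  have GL: "group (GL n :: 'a mat monoid)"
    unfolding GL_def
    by (rule monoid.units_group) (rule ring.is_monoid[OF ring_mat])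
  have one: "\<rho> (?c []) = 1\<^sub>m n"
    using hom_one[OF hom group_presented_group[OF R] GL]
    by (simp add: GL_def units_of_one ring_mat_simps presented_group_def)
  have carrier: "\<rho> (?c u) \<in> carrier_mat n n" if "u \<in> words X" for u
  proof -
    have "?c u \<in> carrier ?G" using that by (simp add: presented_group_def)
    then have "\<rho> (?c u) \<in> carrier (GL n)" using hom by (rule hom_in_carrier[rotated])
    then show ?thesis by (simp add: GL_def units_of_carrier Units_def ring_mat_simps)
  qed
  have mult: "\<rho> (?c (u @ w)) = \<rho> (?c u) * \<rho> (?c w)" if "u \<in> words X" "w \<in> words X" for u w
  proof -
    have "?c u \<in> carrier ?G" "?c w \<in> carrier ?G" using that by (simp_all add: presented_group_def)
    from hom_mult[OF hom this] show ?thesis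
      by (simp add: pres_class_mult[OF R that] GL_def units_of_mult ring_mat_simps)
  qed
  have letter: "\<rho> (?c [(g, e)]) *\<^sub>v x = x" if g: "g \<in> X" for g e
  proof (cases e)
    case True
    then show ?thesis using gens[OF g] by (simp add: pos_word_def)
  next
    case False
    have w: "[(g, e)] \<in> words X" for e using g by (simp add: words_def)
    have "pres_eq X R ([] @ [(g, False), (g, \<not> False)] @ []) ([] @ [])"
      by (rule pres_eq.cancel) (use g in \<open>auto simp: words_def\<close>)
    then have "?c ([(g, False)] @ [(g, True)]) = ?c []"
      using g by (subst pres_class_eq_iff[OF R]) (auto simp: words_def)
    then have "\<rho> (?c [(g, False)]) * \<rho> (?c [(g, True)]) = 1\<^sub>m n"
      using mult[OF w w] one by metis
    then have "x = (\<rho> (?c [(g, False)]) * \<rho> (?c [(g, True)])) *\<^sub>v x"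
      using x by simp
    also have "\<dots> = \<rho> (?c [(g, False)]) *\<^sub>v (\<rho> (?c [(g, True)]) *\<^sub>v x)"
      by (rule assoc_mult_mat_vec[OF carrier[OF w] carrier[OF w] x])
    also have "\<dots> = \<rho> (?c [(g, False)]) *\<^sub>v x"
      using gens[OF g] by (simp add: pos_word_def)
    finally show ?thesis using False by simp
  qed
  have "\<rho> (?c w) *\<^sub>v x = x" if "w \<in> words X" for w
    using that
  proof (induction w)
    case Nil
    then show ?case using x one by simp
  next
    case (Cons y w)
    obtain g e where y: "y = (g, e)" by (cases y)
    from Cons.prems y have g: "g \<in> X" and w: "w \<in> words X" by (auto simp: words_def)
    have y': "[(g, e)] \<in> words X" using g by (simp add: words_def)
    have "\<rho> (?c (y # w)) = \<rho> (?c [(g, e)]) * \<rho> (?c w)"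
      using mult[OF y' w] by (simp add: y)
    then show ?case
      using Cons.IH[OF w] letter[OF g] assoc_mult_mat_vec[OF carrier[OF y'] carrier[OF w] x]
      by simp
  qed
  then show ?thesis using A by (auto simp: presented_group_def)
qed


section \<open>Pure submodules\<close>

lemma vec_subspaceD:
  assumes "vec_subspace n W"
  shows "W \<subseteq> carrier_vec n" "0\<^sub>v n \<in> W"
    "\<And>x y. x \<in> W \<Longrightarrow> y \<in> W \<Longrightarrow> x + y \<in> W"
    "\<And>c x. x \<in> W \<Longrightarrow> c \<cdot>\<^sub>v x \<in> W"
    "\<And>x y. x \<in> W \<Longrightarrow> y \<in> W \<Longrightarrow> x - y \<in> W"
    "\<And>r x. r \<noteq> 0 \<Longrightarrow> x \<in> carrier_vec n \<Longrightarrow> r \<cdot>\<^sub>v x \<in> W \<Longrightarrow> x \<in> W"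
proof -
  show W: "W \<subseteq> carrier_vec n" "0\<^sub>v n \<in> W"
    and add: "\<And>x y. x \<in> W \<Longrightarrow> y \<in> W \<Longrightarrow> x + y \<in> W"
    and sm: "\<And>c x. x \<in> W \<Longrightarrow> c \<cdot>\<^sub>v x \<in> W"
    and "\<And>r x. r \<noteq> 0 \<Longrightarrow> x \<in> carrier_vec n \<Longrightarrow> r \<cdot>\<^sub>v x \<in> W \<Longrightarrow> x \<in> W"
    using assms unfolding vec_subspace_def submodule_vec_iff by blast+
  fix x y assume "x \<in> W" "y \<in> W"
  moreover from this have "x - y = x + (- 1) \<cdot>\<^sub>v y" using W by (auto intro!: eq_vecI)
  ultimately show "x - y \<in> W" using add sm by metis
qed

lemma vec_subspace_eq_carrier_if_unit_vecs:
  assumes W: "vec_subspace n W" and unit: "\<And>i. i < n \<Longrightarrow> unit_vec n i \<in> W"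
  shows "W = carrier_vec n"
proof
  show "carrier_vec n \<subseteq> W"
  proof
    fix x :: "'a vec" assume x: "x \<in> carrier_vec n"
    have "m \<le> n \<Longrightarrow> vec n (\<lambda>i. if i < m then x $ i else 0) \<in> W" for m
    proof (induction m)
      case 0
      have "vec n (\<lambda>i. if i < 0 then x $ i else 0) = 0\<^sub>v n" by auto
      then show ?case using vec_subspaceD(2)[OF W] by simp
    next
      case (Suc m)
      have "vec n (\<lambda>i. if i < Suc m then x $ i else 0) =
          vec n (\<lambda>i. if i < m then x $ i else 0) + x $ m \<cdot>\<^sub>v unit_vec n m"
        using Suc.prems by (intro eq_vecI) (auto simp: less_Suc_eq)
      then show ?case
        using Suc vec_subspaceD(3,4)[OF W] unit[of m] by simp
    qed
    from this[of n] have "vec n (\<lambda>i. if i < n then x $ i else 0) \<in> W" by simp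
    moreover have "vec n (\<lambda>i. if i < n then x $ i else 0) = x" using x by auto
    ultimately show "x \<in> W" by simp
  qed
qed (rule vec_subspaceD(1)[OF W])

text \<open>
  Used for the coordinates of a vector, and for the membership of unit vectors in a subspace,
  where equality is equivalence.
\<close>

lemma eq_if_adjacent_eq:
  fixes f :: "nat \<Rightarrow> 'a"
  assumes step: "\<And>k. Suc k < n \<Longrightarrow> f (Suc k) = f k" and "i < n" "j < n"
  shows "f i = f j"
proof -
  have "i < n \<Longrightarrow> f i = f 0" for i by (induction i) (use step in simp_all)
  from this[OF assms(2)] this[OF assms(3)] show ?thesis by simp
qed

text \<open>
  Constancy is expressed by comparing neighbours because \<open>x\<^bsub>k+1\<^esub> = x\<^sub>k\<close> is the
  condition under which \<open>S\<^sub>k\<close> fixes \<open>x\<close>.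
\<close>

definition constant_vecs :: "nat \<Rightarrow> 'a vec set" where
  "constant_vecs n = {x \<in> carrier_vec n. \<forall>k. Suc k < n \<longrightarrow> x $ Suc k = x $ k}"

lemma vec_subspace_constant_vecs: "vec_subspace n (constant_vecs n)"
  unfolding vec_subspace_def submodule_vec_iff by (auto simp: constant_vecs_def)

lemma constant_vecs_proper:
  assumes "n \<ge> 2"
  shows "constant_vecs n \<noteq> {0\<^sub>v n :: 'a :: idom vec}"
    and "constant_vecs n \<noteq> (carrier_vec n :: 'a :: idom vec set)"
proof -
  have "vec n (\<lambda>_. 1 :: 'a) \<in> constant_vecs n" by (simp add: constant_vecs_def)
  moreover have "vec n (\<lambda>_. 1 :: 'a) $ 0 \<noteq> 0\<^sub>v n $ 0" using assms by simp
  ultimately show "constant_vecs n \<noteq> {0\<^sub>v n :: 'a vec}" by force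
  have "unit_vec n 0 $ Suc 0 \<noteq> (unit_vec n 0 $ 0 :: 'a)" using assms by simp
  moreover have "Suc 0 < n" using assms by simp
  ultimately have "unit_vec n 0 \<notin> (constant_vecs n :: 'a vec set)"
    unfolding constant_vecs_def by blast
  then show "constant_vecs n \<noteq> (carrier_vec n :: 'a vec set)" using unit_vec_carrier by blast
qed


section \<open>Irreducibility over an integral domain\<close>

text \<open>
  Let \<open>S\<^sub>k\<close> and \<open>N\<^sub>k\<close> be the matrices in the two invariance hypotheses.  The inequalities
  \<open>ndep\<close> say that \<open>N\<^sub>k\<close> does not fix the vector
  \<open>u\<^sub>k\<close> which spans the image of \<open>S\<^sub>k - 1\<close>, and that \<open>u\<^sub>k\<close> is not a multiple of the
  vector \<open>w\<^sub>k\<close> which spans the image of \<open>N\<^sub>k - 1\<close>.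
\<close>

lemma no_proper_common_invariant_subspace:
  fixes t v v_inv :: "'a :: idom"
  assumes n: "n \<ge> 3" and W: "vec_subspace n W" and nz: "W \<noteq> {0\<^sub>v n}"
    and S: "\<And>k x. Suc k < n \<Longrightarrow> x \<in> W \<Longrightarrow>
      adjacent_block_mat n k (1 - t) t (2 - t) (t - 1) *\<^sub>v x \<in> W"
    and N: "\<And>k x. Suc k < n \<Longrightarrow> x \<in> W \<Longrightarrow> adjacent_block_mat n k 0 v v_inv 0 *\<^sub>v x \<in> W"
    and inv: "v * v_inv = 1" and v1: "v \<noteq> 1"
    and ndep: "v * (t - 2) \<noteq> t" "v * (t - 2) \<noteq> - t"
  shows "W = carrier_vec n"
proof -
  note sub = vec_subspaceD(1)[OF W]
    and sm = vec_subspaceD(4)[OF W] and diff = vec_subspaceD(5)[OF W]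
    and pure = vec_subspaceD(6)[OF W]
  have carr: "x \<in> carrier_vec n" if "x \<in> W" for x using sub that by blast
  have v_inv1: "v_inv \<noteq> 1" using inv v1 by auto
  have "\<exists>y k. y \<in> W \<and> Suc k < n \<and> y $ k \<noteq> y $ Suc k"
  proof (rule ccontr)
    assume "\<not> ?thesis"
    then have const: "y $ i = y $ j" if "y \<in> W" "i < n" "j < n" for y i j
      using eq_if_adjacent_eq[of n "\<lambda>i. y $ i", OF _ that(2,3)] that(1) by metis
    obtain x where x: "x \<in> W" "x \<noteq> 0\<^sub>v n" using nz vec_subspaceD(2)[OF W] by blast
    \<comment> \<open>The matrix that swaps the first two coordinates changes the second entry of a constant vector
      by the factor \<open>v_inv\<close> and keeps the third.\<close>
    let ?y = "adjacent_block_mat n 0 0 v v_inv 0 *\<^sub>v x"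
    have "?y \<in> W" using N[of 0] n x by simp
    then have "?y $ 1 = ?y $ 2" using n by (intro const) auto
    moreover have "?y $ 1 = v_inv * x $ 0" "?y $ 2 = x $ 2"
      using n by (simp_all add: adjacent_block_mat_mult_vec carr[OF x(1)])
    ultimately have "(v_inv - 1) * x $ 0 = 0"
      using const[OF x(1), of 2 0] n by (simp add: algebra_simps)
    then have "x $ 0 = 0" using v_inv1 by simp
    then have "x $ i = 0" if "i < n" for i using const[OF x(1) that, of 0] n by simp
    then have "x = 0\<^sub>v n" using carr[OF x(1)] by auto
    with x(2) show False ..
  qed
  then obtain y k where y: "y \<in> W" and k: "Suc k < n" and yk: "y $ k \<noteq> y $ Suc k" by blast
  define u where "u = t \<cdot>\<^sub>v unit_vec n k + (t - 2) \<cdot>\<^sub>v unit_vec n (Suc k)"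
  define w where "w = unit_vec n k - v_inv \<cdot>\<^sub>v unit_vec n (Suc k)"
  have u: "u \<in> W"
  proof (rule pure)
    have "(y $ Suc k - y $ k) \<cdot>\<^sub>v u =
        adjacent_block_mat n k (1 - t) t (2 - t) (t - 1) *\<^sub>v y - y"
      using k carr[OF y]
      by (intro eq_vecI) (auto simp: u_def adjacent_block_mat_mult_vec algebra_simps)
    then show "(y $ Suc k - y $ k) \<cdot>\<^sub>v u \<in> W" using diff[OF S[OF k y] y] by simp
  qed (use yk in \<open>auto simp: u_def\<close>)
  have w: "w \<in> W"
  proof (rule pure)
    have "(v * (t - 2) - t) \<cdot>\<^sub>v w = adjacent_block_mat n k 0 v v_inv 0 *\<^sub>v u - u"
    proof (rule eq_vecI)
      have "v_inv * (v * (t - 2)) = t - 2" using inv by (simp add: mult.commute mult.left_commute)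
      fix i assume "i < dim_vec (adjacent_block_mat n k 0 v v_inv 0 *\<^sub>v u - u)"
      then show "((v * (t - 2) - t) \<cdot>\<^sub>v w) $ i =
          (adjacent_block_mat n k 0 v v_inv 0 *\<^sub>v u - u) $ i"
        using k carr[OF u] \<open>v_inv * (v * (t - 2)) = t - 2\<close>
        by (auto simp: w_def u_def adjacent_block_mat_mult_vec algebra_simps)
    qed (use carr[OF u] in \<open>simp add: w_def u_def\<close>)
    then show "(v * (t - 2) - t) \<cdot>\<^sub>v w \<in> W" using diff[OF N[OF k u] u] by simp
  qed (use ndep in \<open>auto simp: w_def\<close>)
  have e: "unit_vec n (Suc k) \<in> W"
  proof (rule pure)
    \<comment> \<open>The scalar is the determinant of \<open>w\<close> and \<open>u\<close> in the coordinates \<open>k\<close> and \<open>k + 1\<close>.\<close>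
    have "(t - 2 + t * v_inv) \<cdot>\<^sub>v unit_vec n (Suc k) = u - t \<cdot>\<^sub>v w"
      using k by (intro eq_vecI) (auto simp: u_def w_def algebra_simps)
    then show "(t - 2 + t * v_inv) \<cdot>\<^sub>v unit_vec n (Suc k) \<in> W" using diff[OF u sm[OF w]] by simp
    have "v * (t - 2 + t * v_inv) = v * (t - 2) + t * (v * v_inv)" by (simp add: algebra_simps)
    also have "\<dots> = v * (t - 2) + t" using inv by simp
    finally show "t - 2 + t * v_inv \<noteq> 0"
      using ndep(2) by (metis add.commute add_eq_0_iff mult_zero_right)
  qed auto
  have up: "unit_vec n (Suc j) \<in> W" if "Suc j < n" "unit_vec n j \<in> W" for j
  proof -
    have "v \<cdot>\<^sub>v (adjacent_block_mat n j 0 v v_inv 0 *\<^sub>v unit_vec n j) = unit_vec n (Suc j)"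
      using that inv by (intro eq_vecI) (auto simp: adjacent_block_mat_mult_vec)
    then show ?thesis using sm[OF N[OF that]] by metis
  qed
  have down: "unit_vec n j \<in> W" if "Suc j < n" "unit_vec n (Suc j) \<in> W" for j
  proof -
    have "v_inv \<cdot>\<^sub>v (adjacent_block_mat n j 0 v v_inv 0 *\<^sub>v unit_vec n (Suc j)) = unit_vec n j"
      using that inv by (intro eq_vecI) (auto simp: adjacent_block_mat_mult_vec mult.commute)
    then show ?thesis using sm[OF N[OF that]] by metis
  qed
  have "(unit_vec n i \<in> W) = (unit_vec n (Suc k) \<in> W)" if "i < n" for i
    using eq_if_adjacent_eq[of n "\<lambda>i. unit_vec n i \<in> W", OF _ that k] up down by metis
  then show ?thesis using e by (intro vec_subspace_eq_carrier_if_unit_vecs[OF W]) auto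
qed


section \<open>Laurent polynomials\<close>

lemma lookup_mult_indet:
  fixes v :: laurent
  shows "Poly_Mapping.lookup (v * indet) k = Poly_Mapping.lookup v (k - 1)"
proof -
  have eq: "(k = 1 + q) = (q = k - 1)" for q :: int by auto
  have "Poly_Mapping.lookup (indet * v) k =
    Sum_any (\<lambda>l. Sum_any (\<lambda>q. Poly_Mapping.lookup v q when k = l + q) when l = 1)"
    unfolding lookup_mult by (rule Sum_any.cong) (simp add: indet_def lookup_single when_def)
  also have "\<dots> = Sum_any (\<lambda>q. Poly_Mapping.lookup v q when q = k - 1)"
    unfolding Sum_any_when_equal eq ..
  also have "\<dots> = Poly_Mapping.lookup v (k - 1)" by (rule Sum_any_when_equal)
  finally show ?thesis by (simp only: mult.commute)
qed

text \<open>
  Comparing coefficients in \<open>v (t - 2) = r t\<close> gives \<open>v\<^bsub>k-1\<^esub> = 2 v\<^sub>k\<close> for \<open>k \<noteq> 1\<close> and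
  \<open>v\<^sub>0 = 2 v\<^sub>1 + r\<close>.  So \<open>v\<^sub>0\<close> is odd, hence nonzero, and the coefficients double at every
  step towards smaller exponents, so that the support of \<open>v\<close> would be infinite.
\<close>

lemma indet_minus_2_not_dvd_odd_linear_monomial:
  assumes "odd r"
  shows "\<not> indet - 2 dvd (Poly_Mapping.single 1 r :: laurent)"
proof
  assume "indet - 2 dvd (Poly_Mapping.single 1 r :: laurent)"
  then obtain v where "Poly_Mapping.single 1 r = (indet - 2) * v" by (elim dvdE)
  then have eq: "v * (indet - 2) = Poly_Mapping.single 1 r" by (simp add: mult.commute)
  have rec: "Poly_Mapping.lookup v (k - 1) = 2 * Poly_Mapping.lookup v k + (r when k = 1)" for k
  proof -
    have "v * (indet - 2) = v * indet - (v + v)" by (simp add: algebra_simps)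
    then have "Poly_Mapping.lookup (Poly_Mapping.single 1 r) k =
        Poly_Mapping.lookup v (k - 1) - (Poly_Mapping.lookup v k + Poly_Mapping.lookup v k)"
      unfolding eq[symmetric] by (simp only: lookup_minus lookup_add lookup_mult_indet)
    then show ?thesis by (auto simp: lookup_single when_def)
  qed
  have "Poly_Mapping.lookup v (- int j) \<noteq> 0" for j
  proof (induction j)
    case 0
    have "odd (Poly_Mapping.lookup v 0)" using rec[of 1] assms by simp
    then show ?case by auto
  next
    case (Suc j)
    have "- int (Suc j) = - int j - 1" by simp
    then show ?case using Suc.IH rec[of "- int j"] by (simp only:) (simp add: when_def)
  qed
  then have "range (\<lambda>j. - int j) \<subseteq> Poly_Mapping.keys v" by (auto simp: in_keys_iff)
  then have "finite (range (\<lambda>j. - int j))" by (rule finite_subset) simp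
  then show False by (simp add: finite_image_iff inj_on_def)
qed


section \<open>The criterion\<close>

theorem theorem15:
  fixes n :: nat and v v_inv :: laurent and \<eta> :: "vst_gen word set \<Rightarrow> laurent mat"
  assumes "n \<ge> 3"
    and "v * v_inv = 1"
    and "\<eta> \<in> hom (VST n) (GL n)"
    and "\<And>i. i \<in> {1..n - 1} \<Longrightarrow> \<eta> (vst_s n i) =
      diag_block_mat [1\<^sub>m (i - 1),
                      mat_of_rows_list 2 [[1 - indet, indet], [2 - indet, indet - 1]],
                      1\<^sub>m (n - i - 1)]"
    and "\<And>i. i \<in> {1..n - 1} \<Longrightarrow> \<eta> (vst_tau n i) = 1\<^sub>m n"
    and "\<And>i. i \<in> {1..n - 1} \<Longrightarrow> \<eta> (vst_nu n i) =
      diag_block_mat [1\<^sub>m (i - 1),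
                      mat_of_rows_list 2 [[0, v], [v_inv, 0]],
                      1\<^sub>m (n - i - 1)]"
  shows "irreducible_rep (VST n) n \<eta> \<longleftrightarrow> v \<noteq> 1"
proof -
  let ?S = "\<lambda>k. adjacent_block_mat n k (1 - indet) indet (2 - indet) (indet - 1) :: laurent mat"
  let ?N = "\<lambda>k. adjacent_block_mat n k 0 v v_inv 0"
  have s: "\<eta> (vst_s n (Suc k)) = ?S k" and nu: "\<eta> (vst_nu n (Suc k)) = ?N k"
    if "Suc k < n" for k
    using that assms(4,6)[of "Suc k"] by (simp_all add: adjacent_block_mat_def)
  have elem: "vst_elem n g \<in> carrier (VST n)" if "g \<in> vst_gens n" for g
    using that by (auto simp: vst_elem_def VST_def presented_group_def words_def pos_word_def)
  show ?thesis
  proof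
    assume irr: "irreducible_rep (VST n) n \<eta>"
    show "v \<noteq> 1"
    proof
      assume v: "v = 1"
      with assms(2) have v_inv: "v_inv = 1" by simp
      let ?C = "constant_vecs n :: laurent vec set"
      have fixed: "\<eta> g *\<^sub>v x = x" if x: "x \<in> ?C" and g: "g \<in> carrier (VST n)" for x g
      proof (rule fixed_by_presented_group[OF vst_word_rels_words])
        show "\<eta> \<in> hom (presented_group (vst_gens n) (vst_word_rels n)) (GL n)"
          using assms(3) by (simp add: VST_def)
        show "g \<in> carrier (presented_group (vst_gens n) (vst_word_rels n))"
          using g by (simp add: VST_def)
        show xn: "x \<in> carrier_vec n" using x by (simp add: constant_vecs_def)
        fix h assume "h \<in> vst_gens n"
        then obtain i where i: "i \<in> {1..n - 1}" and h: "h \<in> {Gen_s i, Gen_tau i, Gen_nu i}"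
          by (auto simp: vst_gens_def)
        define k where "k = i - 1"
        have ik: "i = Suc k" and k: "Suc k < n" using i by (auto simp: k_def)
        have xk: "x $ Suc k = x $ k" using x k by (simp add: constant_vecs_def)
        have "?S k *\<^sub>v x = x" "?N k *\<^sub>v x = x"
          using k xn xk by (auto simp: adjacent_block_mat_mult_vec v v_inv algebra_simps intro!: eq_vecI)
        then have "\<eta> (vst_elem n h) *\<^sub>v x = x"
          using h s[OF k] nu[OF k] assms(5)[OF i] xn by (auto simp: ik)
        then show "\<eta> (pres_class (vst_gens n) (vst_word_rels n) (pos_word [h])) *\<^sub>v x = x"
          by (simp add: vst_elem_def)
      qed
      have "invariant_subspace (VST n) n \<eta> ?C"
        unfolding invariant_subspace_def using vec_subspace_constant_vecs fixed by simp
      then show False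
        using irr constant_vecs_proper[of n] assms(1) unfolding irreducible_rep_def by fastforce
    qed
  next
    assume v: "v \<noteq> 1"
    have "W = carrier_vec n" if W: "invariant_subspace (VST n) n \<eta> W" and "W \<noteq> {0\<^sub>v n}" for W
    proof (rule no_proper_common_invariant_subspace[of n W indet v v_inv])
      have "Gen_s (Suc k) \<in> vst_gens n" "Gen_nu (Suc k) \<in> vst_gens n" if "Suc k < n" for k
        using that by (force simp: vst_gens_def)+
      then show "?S k *\<^sub>v x \<in> W" "?N k *\<^sub>v x \<in> W" if "Suc k < n" "x \<in> W" for k x
        using that W elem s nu unfolding invariant_subspace_def by metis+
      have "\<not> indet - 2 dvd (indet :: laurent)" "\<not> indet - 2 dvd (- indet :: laurent)"
        using indet_minus_2_not_dvd_odd_linear_monomial[of 1]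
          indet_minus_2_not_dvd_odd_linear_monomial[of "- 1"]
        unfolding indet_def single_uminus by simp_all
      then show "v * (indet - 2) \<noteq> indet" "v * (indet - 2) \<noteq> - indet"
        using dvd_triv_right[of "indet - 2" v] by metis+
    qed (use that v assms(1,2) in \<open>auto simp: invariant_subspace_def\<close>)
    then show "irreducible_rep (VST n) n \<eta>" unfolding irreducible_rep_def by blast
  qed
qed

end
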